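(* The monoid $\mathbb{M}_2$ of intervals in the posets $(\mathscr{D}_n,\leq)$, $n\geq 1$, is free, with generators all intervals whose maximal element has the shape $(1,w,1,0,0)$ for some Dyck path $w$ (of any size $\geq 0$), together with the interval $[(1,0,1,0),(1,0,1,0)]$ in $\mathscr{D}_2$.
   Context: A Dyck path of size $n\geq 0$ is a word of length $2n$ in the letters $0,1$ with $n$ letters $1$ and $n$ letters $0$ such that every prefix contains at least as many $1$'s as $0$'s (the height after a prefix is its number of $1$'s minus its number of $0$'s). Let $\mathscr{D}_n$ be the set of Dyck paths of size $n$. A subpath of a Dyck path $w$ is a non-empty sequence $x$ of consecutive letters of $w$ that starts and ends at the same height and stays strictly above that height in between. A subpath $x$ is movable in $w$ if it is immediately preceded in $w$ by the letter $0$ and either $x$ ends at the last letter of $w$ or $x$ is immediately followed in $w$ by the letter $1$. For a movable subpath $x$, let $N=N(w,x)\geq 1$ be the number of consecutive letters $0$ just before $x$, so $w=a\,0^{N}\,x\,b$ where $a$ does not end with $0$; for $1\leq i\leq N$ let $M(w,x,i)=a\,0^{N-i}\,x\,0^{i}\,b\in\mathscr{D}_n$. Let $\Gamma_n$ be the directed graph on $\mathscr{D}_n$ with edges $w\to M(w,x,i)$ for all movable $x$ in $w$ and all $1\leq i\leq N(w,x)$. The dexter order is: $u\leq v$ if and only if there is a directed path (possibly of length $0$) from $u$ to $v$ in $\Gamma_n$. This is a partial order whose cover relations are exactly the edges of $\Gamma_n$. Product $\sharp$ on non-empty Dyck paths: for a non-empty Dyck path $w$, let $\overline{w}$ be the word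 obtained by removing its first and last letters (a pseudo-Dyck path; its height, starting at $0$, may reach $-1$). For pseudo-Dyck paths $p,q$, write $p=(p',0^k)$ where $p'$ is empty (if $p$ is empty) or ends with $1$, and $q=q'q''$ where $q'$ is the largest prefix of $q$ in which the height stays $\geq 0$; set $p\ast q=(p',q',0^k,q'')$. Then $u\,\sharp\,v=(1,\overline{u}\ast\overline{v},0)$. This is associative with unit $(1,0)$; if $u\in\mathscr{D}_m$ and $v\in\mathscr{D}_n$ then $u\,\sharp\,v\in\mathscr{D}_{m+n-1}$. Monoid $\mathbb{M}_2$: its elements are all intervals $[w,w']$ (i.e. pairs $w\leq w'$ in $\mathscr{D}_n$) for all $n\geq 1$, with product $[w_1,w_1']\,\sharp\,[w_2,w_2']=[w_1\,\sharp\,w_2,\;w_1'\,\sharp\,w_2']$, which is well defined since $w_1\leq w_1'$ and $w_2\leq w_2'$ imply $w_1\,\sharp\,w_2\leq w_1'\,\sharp\,w_2'$. Its unit is the unique interval in $\mathscr{D}_1$. *)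

theory Defs
  imports "HOL-Algebra.Group"
begin

datatype letter = One | Zero

type_synonym word = "letter list"

definition height :: "word \<Rightarrow> int" where
  "height w = int (count_list w One) - int (count_list w Zero)"

definition dyck :: "nat \<Rightarrow> word set" where
  "dyck n = {w. length w = 2 * n \<and> count_list w One = n \<and> count_list w Zero = n \<and>
     (\<forall>k\<le>length w. height (take k w) \<ge> 0)}"

text \<open>
  Being a subpath depends only on the factor itself, since heights inside the factor can be
  measured relative to its starting point. Movability also depends on the occurrence, and is
  expressed below through the words surrounding it.
\<close>

definition subpath_word :: "word \<Rightarrow> bool" where
  "subpath_word x \<longleftrightarrow> x \<noteq> [] \<and> height x = 0 \<and>
     (\<forall>k. 0 < k \<and> k < length x \<longrightarrow> height (take k x) > 0)"

text \<open>
  In \<open>w = a 0\<^sup>N x b\<close>, maximality of \<open>N\<close> is the condition that \<open>a\<close> does not end with \<open>0\<close>.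
\<close>

definition dexter_edges :: "nat \<Rightarrow> (word \<times> word) set" where
  "dexter_edges n = {(w, w'). w \<in> dyck n \<and>
     (\<exists>a N x b i. w = a @ replicate N Zero @ x @ b \<and> (a = [] \<or> last a \<noteq> Zero) \<and>
        subpath_word x \<and> N \<ge> 1 \<and> (b = [] \<or> hd b = One) \<and>
        1 \<le> i \<and> i \<le> N \<and>
        w' = a @ replicate (N - i) Zero @ x @ replicate i Zero @ b)}"

definition dexter_le :: "nat \<Rightarrow> word \<Rightarrow> word \<Rightarrow> bool" where
  "dexter_le n u v \<longleftrightarrow> u \<in> dyck n \<and> v \<in> dyck n \<and> (u, v) \<in> (dexter_edges n)\<^sup>*"

definition overline :: "word \<Rightarrow> word" where
  "overline w = butlast (tl w)"

text \<open>
  A word is split as \<open>p = (p', 0\<^sup>k)\<close> with \<open>p'\<close> empty or ending with \<open>1\<close>,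
  and as \<open>q = q' q''\<close> with \<open>q'\<close> its largest prefix staying at height at least \<open>0\<close>.
\<close>

definition strip_zeros :: "word \<Rightarrow> word" where
  "strip_zeros p = rev (dropWhile (\<lambda>l. l = Zero) (rev p))"

definition trailing_zeros :: "word \<Rightarrow> nat" where
  "trailing_zeros p = length (takeWhile (\<lambda>l. l = Zero) (rev p))"

definition nonneg_prefix_length :: "word \<Rightarrow> nat" where
  "nonneg_prefix_length q =
     (GREATEST k. k \<le> length q \<and> (\<forall>j\<le>k. height (take j q) \<ge> 0))"

definition pseudo_prod :: "word \<Rightarrow> word \<Rightarrow> word" where
  "pseudo_prod p q =
     strip_zeros p @ take (nonneg_prefix_length q) q @
     replicate (trailing_zeros p) Zero @ drop (nonneg_prefix_length q) q"

definition sharp :: "word \<Rightarrow> word \<Rightarrow> word" (infixl \<open>\<sharp>\<close> 70) where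
  "u \<sharp> v = [One] @ pseudo_prod (overline u) (overline v) @ [Zero]"

text \<open>An interval is represented by the pair of its minimal and maximal elements.\<close>

definition M2 :: "(word \<times> word) monoid" where
  "M2 = \<lparr>carrier = (\<Union>n\<in>{1..}. {(w, w'). dexter_le n w w'}),
         mult = (\<lambda>(w\<^sub>1, w\<^sub>1') (w\<^sub>2, w\<^sub>2'). (w\<^sub>1 \<sharp> w\<^sub>2, w\<^sub>1' \<sharp> w\<^sub>2')),
         one = ([One, Zero], [One, Zero])\<rparr>"

definition M2_generators :: "(word \<times> word) set" where
  "M2_generators =
     {(u, v). (u, v) \<in> carrier M2 \<and>
        (\<exists>m. \<exists>w\<in>dyck m. v = [One] @ w @ [One, Zero, Zero])} \<union>
     {([One, Zero, One, Zero], [One, Zero, One, Zero])}"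

definition word_monoid :: "'a set \<Rightarrow> 'a list monoid" where
  "word_monoid S = \<lparr>carrier = lists S, mult = (@), one = []\<rparr>"

text \<open>
  A monoid is free on a subset \<open>S\<close> if the canonical homomorphism from the monoid of words
  over \<open>S\<close>, evaluating a word as a product, is an isomorphism. Although \<^const>\<open>iso\<close> does not
  mention units, this map sends the empty word to the unit by construction.
\<close>

definition free_monoid_on :: "('a, 'b) monoid_scheme \<Rightarrow> 'a set \<Rightarrow> bool" where
  "free_monoid_on M S \<longleftrightarrow> monoid M \<and> S \<subseteq> carrier M \<and>
     (\<lambda>xs. foldr (mult M) xs (one M)) \<in> iso (word_monoid S) M"

end

theory Submission
  imports Defs
begin

text \<open>
  Write a non-empty Dyck path \<open>u\<close> as \<open>s 1 0\<^sup>j\<close>, with \<open>0\<^sup>j\<close> its last run of zeros, and \<open>v\<close> as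
  \<open>1 q 0 r\<close> by first return. Then \<open>u \<sharp> v = s 1 q 0\<^sup>j r\<close>. An edge of the dexter graph reads
  \<open>c 0\<^sup>i x b \<rightarrow> c x 0\<^sup>i b\<close>, where the \<open>i\<close> zeros after \<open>x\<close> end a maximal run of zeros. Locating that run
  in \<open>s 1 q 0\<^sup>j r\<close> shows that the edges into \<open>u \<sharp> v\<close> are exactly those induced by an edge into \<open>u\<close> or
  into \<open>v\<close>. Hence the interval below a product is the product of the intervals below the factors, and
  the factorisation of an interval is dictated by that of its maximal element. There, the last factor
  can be split off: a path ending in \<open>1 0\<close> is \<open>u \<sharp> 1010\<close>, and one of the form \<open>s 1 w 1 0\<^sup>j\<close> with \<open>w\<close>
  Dyck and \<open>j \<ge> 2\<close> is the product of \<open>s 1 0\<^sup>j\<^sup>-\<^sup>1\<close> with \<open>1w100\<close>. Since the product is cancellative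
  once the sizes of the factors are fixed, this determines the lower bounds as well.
\<close>

section \<open>Heights and Dyck words\<close>

lemma height_simps [simp]:
  "height [] = 0" "height (One # w) = 1 + height w" "height (Zero # w) = height w - 1"
  "height (a @ b) = height a + height b" "height (replicate i Zero) = - int i"
proof -
  show "height (replicate i Zero) = - int i" by (induction i) (auto simp: height_def)
qed (auto simp: height_def)

text \<open>The running start height makes the prefix condition split along \<open>@\<close> (see
  \<open>above_append\<close>), so that path conditions on concatenations are settled by
  simplification.\<close>

fun above :: "int \<Rightarrow> word \<Rightarrow> bool" where
  "above h [] \<longleftrightarrow> h \<ge> 0"
| "above h (One # w) \<longleftrightarrow> h \<ge> 0 \<and> above (h + 1) w"
| "above h (Zero # w) \<longleftrightarrow> h \<ge> 0 \<and> above (h - 1) w"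

lemma above_start: "above h w \<Longrightarrow> h \<ge> 0"
  by (cases "(h, w)" rule: above.cases) auto

lemma above_append [simp]: "above h (a @ b) \<longleftrightarrow> above h a \<and> above (h + height a) b"
proof (induction h a rule: above.induct)
  case (1 h)
  then show ?case using above_start by auto
qed (auto simp: algebra_simps)

lemma above_end: "above h w \<Longrightarrow> h + height w \<ge> 0"
  by (induction h w rule: above.induct) auto

lemma above_mono: "above h w \<Longrightarrow> h \<le> h' \<Longrightarrow> above h' w"
  by (induction h w arbitrary: h' rule: above.induct) auto

lemma above_zeros [simp]: "above h (replicate i Zero) \<longleftrightarrow> h \<ge> int i"
  by (induction i arbitrary: h) auto

text \<open>Bridge to the prefix condition in \<open>dyck\<close>. The converse extends the word at
  its end, because a new last letter creates only one new prefix.\<close>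

lemma above_iff_take: "above h w \<longleftrightarrow> (\<forall>k\<le>length w. h + height (take k w) \<ge> 0)"
proof (intro iffI allI impI)
  fix k assume "above h w"
  then have "above h (take k w)" by (metis above_append append_take_drop_id)
  then show "h + height (take k w) \<ge> 0" by (rule above_end)
next
  assume "\<forall>k\<le>length w. h + height (take k w) \<ge> 0"
  then show "above h w"
  proof (induction w rule: rev_induct)
    case (snoc x w)
    have "above h w"
    proof (rule snoc.IH, intro allI impI)
      fix k assume "k \<le> length w"
      then show "h + height (take k w) \<ge> 0" using snoc.prems[rule_format, of k] by simp
    qed
    moreover have "h + height (w @ [x]) \<ge> 0"
      using snoc.prems[rule_format, of "length (w @ [x])"] by simp
    ultimately show ?case using above_end[of h w] by (cases x) auto
  qed auto
qed

text \<open>Dyck words of unspecified size, for factors of a path whose size is not tracked.\<close>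

definition bal :: "word \<Rightarrow> bool" where
  "bal w \<longleftrightarrow> above 0 w \<and> height w = 0"

lemma bal_Nil [simp]: "bal []"
  by (simp add: bal_def)

lemma above_pos [simp]: "0 < h \<Longrightarrow> above 0 w \<Longrightarrow> above h w"
  by (rule above_mono) auto

lemma bal_suffix: "bal (a @ b) \<Longrightarrow> height b \<le> 0"
  using above_end[of 0 a] by (auto simp: bal_def)

lemma bal_hd: "bal w \<Longrightarrow> w = [] \<or> hd w = One"
  by (cases "(0::int, w)" rule: above.cases) (auto simp: bal_def dest: above_start)

lemma length_count: "length w = count_list w One + count_list w Zero"
proof (induction w)
  case (Cons x w)
  then show ?case by (cases x) auto
qed simp

lemma dyck_iff: "w \<in> dyck n \<longleftrightarrow> bal w \<and> count_list w One = n"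
  using length_count[of w]
  by (auto simp: dyck_def bal_def above_iff_take height_def)

lemma length_dyck: "w \<in> dyck n \<Longrightarrow> length w = 2 * n"
  by (simp add: dyck_def)

text \<open>The displayed \<open>Zero\<close> is the first step below the start. If \<open>t\<close>
  begins with \<open>One\<close>, the first such step of the tail closes an arch of height 0, and
  the search resumes after that arch.\<close>

lemma negative_height_split:
  "height t < 0 \<Longrightarrow> \<exists>q r. t = q @ Zero # r \<and> bal q"
proof (induction t rule: length_induct)
  case (1 t)
  show ?case
  proof (cases t)
    case (Cons x t')
    show ?thesis
    proof (cases x)
      case One
      then have "height t' < 0" using 1 Cons by simp
      then obtain q r where qr: "t' = q @ Zero # r" "bal q" using 1 Cons by auto
      then have "height r < 0" using 1 Cons One by (simp add: bal_def)
      then obtain q' r' where "r = q' @ Zero # r'" "bal q'"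
        using 1(1)[rule_format, of r] Cons qr by auto
      then have "t = (One # q @ Zero # q') @ Zero # r'" "bal (One # q @ Zero # q')"
        using Cons One qr by (auto simp: bal_def)
      then show ?thesis by blast
    next
      case Zero
      then show ?thesis using Cons bal_Nil by (metis append_Nil)
    qed
  qed (use 1 in simp)
qed

text \<open>Mirror image of \<open>negative_height_split\<close>: the displayed \<open>One\<close>
  is the last ascent to the final height. A final \<open>Zero\<close> closes an arch, which is
  skipped.\<close>

lemma positive_height_split:
  "height s > 0 \<Longrightarrow> \<exists>s' w. s = s' @ One # w \<and> bal w"
proof (induction s rule: length_induct)
  case (1 s)
  show ?case
  proof (cases s rule: rev_cases)
    case (snoc t x)
    show ?thesis
    proof (cases x)
      case Zero
      then have "height t > 0" using 1 snoc by simp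
      then obtain s' w where sw: "t = s' @ One # w" "bal w" using 1 snoc by auto
      then have "height s' > 0" using 1 snoc Zero by (simp add: bal_def)
      then obtain s'' w' where "s' = s'' @ One # w'" "bal w'"
        using 1(1)[rule_format, of s'] snoc sw by auto
      then have "s = s'' @ One # (w' @ One # w @ [Zero])" "bal (w' @ One # w @ [Zero])"
        using snoc Zero sw by (auto simp: bal_def)
      then show ?thesis by blast
    next
      case One
      then show ?thesis using snoc bal_Nil by blast
    qed
  qed (use 1 in simp)
qed

section \<open>Decompositions of Dyck words and their uniqueness\<close>

lemma dyck_first_return:
  assumes "bal w" "w \<noteq> []"
  obtains q r where "w = One # q @ Zero # r" "bal q" "bal r"
proof -
  obtain t where t: "w = One # t" using assms bal_hd[of w] by (cases w) auto
  then have "height t < 0" using assms by (auto simp: bal_def)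
  then obtain q r where qr: "t = q @ Zero # r" "bal q" using negative_height_split by blast
  then have "bal r" using assms t by (auto simp: bal_def)
  then show ?thesis using that t qr by blast
qed

lemma dyck_last_peak:
  assumes "bal w" "w \<noteq> []"
  obtains s j where "w = s @ One # replicate (Suc j) Zero"
proof -
  have "One \<in> set w" using assms bal_hd[of w] by (cases w) auto
  then obtain s z where sz: "w = s @ One # z" "One \<notin> set z"
    using split_list_last by metis
  have "z = replicate (length z) Zero"
    using sz(2) by (metis letter.exhaust replicate_eqI)
  moreover have "z \<noteq> []" using assms sz above_end[of 0 s] by (auto simp: bal_def)
  ultimately show ?thesis using that sz by (metis length_0_conv not0_implies_Suc)
qed

text \<open>If the two decompositions differed, the balanced word on one side would have the suffix
  \<open>One # w'\<close>, of height 1, against \<open>bal_suffix\<close>.\<close>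

lemma bal_cancel_right:
  assumes "s @ One # w = s' @ One # w'" "bal w" "bal w'"
  shows "s = s' \<and> w = w'"
proof -
  have False if "s' = s @ One # t" "w = t @ One # w'" "bal w" "bal w'" for s s' w w' :: word and t
    using bal_suffix[of t "One # w'"] that by (simp add: bal_def)
  then show ?thesis
    using assms by (auto simp: append_eq_append_conv2 Cons_eq_append_conv append_eq_Cons_conv)
qed

text \<open>The displayed \<open>Zero\<close> is the first step below the start, so neither balanced
  prefix can reach past it.\<close>

lemma bal_cancel_left:
  assumes "q @ Zero # r = q' @ Zero # r'" "bal q" "bal q'"
  shows "q = q' \<and> r = r'"
proof -
  have False if "q' = q @ Zero # t" "bal q" "bal q'" for q q' :: word and t
    using that above_start by (fastforce simp: bal_def)
  then show ?thesis
    using assms by (auto simp: append_eq_append_conv2 Cons_eq_append_conv append_eq_Cons_conv)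
qed

section \<open>The product\<close>

lemma strip_zeros_One: "strip_zeros (s @ One # replicate j Zero) = s @ [One]"
  by (simp add: strip_zeros_def dropWhile_append)

lemma trailing_zeros_One: "trailing_zeros (s @ One # replicate j Zero) = j"
  by (simp add: trailing_zeros_def takeWhile_append)

lemma nonneg_prefix_length_Zero:
  assumes "bal q"
  shows "nonneg_prefix_length (q @ Zero # r) = length q"
  unfolding nonneg_prefix_length_def
proof (rule Greatest_equality)
  have "height (take j q) \<ge> 0" if "j \<le> length q" for j
    using assms that by (auto simp: bal_def above_iff_take)
  then show "length q \<le> length (q @ Zero # r) \<and>
      (\<forall>j\<le>length q. height (take j (q @ Zero # r)) \<ge> 0)" by simp
next
  fix k assume k: "k \<le> length (q @ Zero # r) \<and> (\<forall>j\<le>k. height (take j (q @ Zero # r)) \<ge> 0)"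
  show "k \<le> length q"
  proof (rule ccontr)
    assume "\<not> k \<le> length q"
    then have "height (take (Suc (length q)) (q @ Zero # r)) \<ge> 0"
      using k[THEN conjunct2, rule_format, of "Suc (length q)"] by simp
    then show False using assms by (simp add: bal_def)
  qed
qed

lemma nonneg_prefix_length_bal:
  assumes "bal q"
  shows "nonneg_prefix_length q = length q"
  unfolding nonneg_prefix_length_def
  using assms by (intro Greatest_equality) (auto simp: bal_def above_iff_take)

text \<open>Replaces \<open>overline\<close> and \<open>pseudo_prod\<close> in all later arguments.
  The left word loses one final zero to \<open>overline\<close>, hence \<open>j\<close> zeros are
  carried over; the zero closing the first return of the right word completes them to
  \<open>Suc j\<close>.\<close>

lemma sharp_eq:
  assumes u: "bal (s @ One # replicate (Suc j) Zero)" and "bal q" "bal r"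
  shows "(s @ One # replicate (Suc j) Zero) \<sharp> (One # q @ Zero # r)
    = s @ One # q @ replicate (Suc j) Zero @ r"
proof -
  let ?p = "overline (s @ One # replicate (Suc j) Zero)"
  have zs: "replicate (Suc j) Zero = replicate j Zero @ [Zero]"
    by (simp add: replicate_append_same)
  have p: "One # strip_zeros ?p = s @ [One]" "trailing_zeros ?p = j"
  proof -
    have "One # strip_zeros ?p = s @ [One] \<and> trailing_zeros ?p = j"
    proof (cases s)
      \<comment> \<open>The peak is then also the first letter; balance forces the word
        \<open>10\<close>, whose \<open>overline\<close> is empty.\<close>
      case Nil
      then have "j = 0" using u by (auto simp: bal_def)
      then show ?thesis
        using Nil by (simp add: overline_def strip_zeros_def trailing_zeros_def)
    next
      case (Cons x s')
      have "?p = s' @ One # replicate j Zero"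
        unfolding zs overline_def Cons by (simp add: butlast_append)
      moreover have "x = One" using bal_hd[OF u] Cons by simp
      ultimately show ?thesis using Cons by (simp add: strip_zeros_One trailing_zeros_One)
    qed
    then show "One # strip_zeros ?p = s @ [One]" "trailing_zeros ?p = j" by auto
  qed
  let ?q = "overline (One # q @ Zero # r)"
  have q: "take (nonneg_prefix_length ?q) ?q = q"
    "drop (nonneg_prefix_length ?q) ?q @ [Zero] = Zero # r"
  proof -
    have "take (nonneg_prefix_length ?q) ?q = q \<and>
      drop (nonneg_prefix_length ?q) ?q @ [Zero] = Zero # r"
    proof (cases r rule: rev_cases)
      \<comment> \<open>With \<open>r\<close> empty, \<open>overline\<close> removes the zero of the
        first return itself, and all of \<open>q\<close> is the nonnegative prefix.\<close>
      case Nil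
      then show ?thesis
        using assms by (simp add: overline_def butlast_append nonneg_prefix_length_bal)
    next
      case (snoc r' x)
      have "?q = q @ Zero # r'" using snoc by (simp add: overline_def butlast_append)
      moreover have "x = Zero"
        using \<open>bal r\<close> snoc above_end[of 0 r'] by (cases x) (auto simp: bal_def)
      ultimately show ?thesis using assms snoc by (simp add: nonneg_prefix_length_Zero)
    qed
    then show "take (nonneg_prefix_length ?q) ?q = q"
      "drop (nonneg_prefix_length ?q) ?q @ [Zero] = Zero # r" by auto
  qed
  show ?thesis
  proof -
    have "(s @ One # replicate (Suc j) Zero) \<sharp> (One # q @ Zero # r) = (One # strip_zeros ?p) @ q @
        replicate j Zero @ drop (nonneg_prefix_length ?q) ?q @ [Zero]"
      unfolding sharp_def pseudo_prod_def q(1) p(2) by simp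
    also have "\<dots> = s @ One # q @ replicate (Suc j) Zero @ r"
      unfolding p(1) q(2) by (simp add: replicate_app_Cons_same)
    finally show ?thesis .
  qed
qed

lemma sharp_unit_right:
  assumes "bal u" "u \<noteq> []"
  shows "u \<sharp> [One, Zero] = u"
proof -
  obtain s j where "u = s @ One # replicate (Suc j) Zero" using assms dyck_last_peak by blast
  then show ?thesis using assms sharp_eq[of s j "[]" "[]"] by simp
qed

lemma sharp_unit_left:
  assumes "bal u" "u \<noteq> []"
  shows "[One, Zero] \<sharp> u = u"
proof -
  obtain q r where "u = One # q @ Zero # r" "bal q" "bal r" using assms dyck_first_return by blast
  moreover have "bal ([] @ One # replicate (Suc 0) Zero)" by (simp add: bal_def)
  ultimately show ?thesis using assms sharp_eq[of "[]" 0 q r] by simp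
qed

lemma sharp_dyck:
  assumes "u \<in> dyck (Suc m)" "v \<in> dyck (Suc n)"
  shows "u \<sharp> v \<in> dyck (Suc (m + n))"
proof -
  have uv: "bal u" "u \<noteq> []" "bal v" "v \<noteq> []" using assms by (auto simp: dyck_iff)
  obtain s j where u: "u = s @ One # replicate (Suc j) Zero" using uv dyck_last_peak by blast
  obtain q r where v: "v = One # q @ Zero # r" "bal q" "bal r" using uv dyck_first_return by blast
  have "u \<sharp> v = s @ One # q @ replicate (Suc j) Zero @ r" using sharp_eq uv u v by simp
  moreover have "count_list (replicate k Zero) One = 0" for k
    by (induction k) auto
  ultimately show ?thesis using assms u v by (auto simp: dyck_iff bal_def)
qed

text \<open>The cases say where the last run of zeros of \<open>u \<sharp> v\<close> comes from:
  from \<open>r\<close> if it is non-empty; otherwise from the last run of \<open>q\<close> merged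
  with that of \<open>u\<close>. If both \<open>q\<close> and \<open>r\<close> are empty,
  \<open>v\<close> is the unit.\<close>

lemma sharp_assoc:
  assumes "bal u" "u \<noteq> []" "bal v" "v \<noteq> []" "bal w" "w \<noteq> []"
  shows "(u \<sharp> v) \<sharp> w = u \<sharp> (v \<sharp> w)"
proof -
  obtain s j where u: "u = s @ One # replicate (Suc j) Zero" using assms dyck_last_peak by blast
  obtain q r where v: "v = One # q @ Zero # r" "bal q" "bal r" using assms dyck_first_return by blast
  obtain q' r' where w: "w = One # q' @ Zero # r'" "bal q'" "bal r'"
    using assms dyck_first_return by blast
  have uv: "u \<sharp> v = s @ One # q @ replicate (Suc j) Zero @ r" using sharp_eq assms u v by simp
  have buv: "bal (u \<sharp> v)" using assms u v unfolding uv by (auto simp: bal_def)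
  show ?thesis
  proof (cases "r = []")
    case False
    then obtain t k where r: "r = t @ One # replicate (Suc k) Zero"
      using v dyck_last_peak by blast
    have "(u \<sharp> v) \<sharp> w
        = s @ One # q @ replicate (Suc j) Zero @ t @ One # q' @ replicate (Suc k) Zero @ r'"
      using sharp_eq[of "s @ One # q @ replicate (Suc j) Zero @ t" k q' r'] buv w
      unfolding uv r by simp
    moreover have "v \<sharp> w = One # q @ Zero # t @ One # q' @ replicate (Suc k) Zero @ r'"
      using sharp_eq[of "One # q @ Zero # t" k q' r'] assms v w unfolding r by simp
    moreover have "bal (t @ One # q' @ replicate (Suc k) Zero @ r')"
      using v(3) w(2,3) unfolding r by (auto simp: bal_def)
    ultimately show ?thesis
      using sharp_eq[of s j q "t @ One # q' @ replicate (Suc k) Zero @ r'"] assms u v by simp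
  next
    case r: True
    show ?thesis
    proof (cases "q = []")
      case True
      then have "v = [One, Zero]" using v r by simp
      then show ?thesis using sharp_unit_left sharp_unit_right assms by simp
    next
      case False
      then obtain t k where q: "q = t @ One # replicate (Suc k) Zero"
        using v dyck_last_peak by blast
      have zs: "replicate (Suc k) Zero @ replicate (Suc j) Zero @ x = replicate (Suc (k + Suc j)) Zero @ x"
        "replicate (Suc k) Zero @ Zero # x = replicate (Suc (Suc k)) Zero @ x" for x
        by (simp_all add: replicate_add replicate_app_Cons_same)
      have "(u \<sharp> v) \<sharp> w = s @ One # t @ One # q' @ replicate (Suc (k + Suc j)) Zero @ r'"
        using sharp_eq[of "s @ One # t" "k + Suc j" q' r'] buv w zs(1)[of "[]"]
        unfolding uv r q by simp
      moreover have "v \<sharp> w = One # t @ One # q' @ replicate (Suc (Suc k)) Zero @ r'"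
        using sharp_eq[of "One # t" "Suc k" q' r'] assms v w zs(2)[of "[]"] unfolding r q by simp
      moreover have "bal (t @ One # q' @ replicate (Suc k) Zero)"
        using v(2) w(2,3) unfolding q by (auto simp: bal_def)
      ultimately show ?thesis
        using sharp_eq[of s j "t @ One # q' @ replicate (Suc k) Zero" r'] assms u w zs
        by (simp del: replicate.simps)
    qed
  qed
qed

text \<open>With equal counts before them, both displayed letters \<open>One\<close> are the same
  occurrence in the common word.\<close>

lemma prefix_One_cancel:
  assumes "s @ One # t = s' @ One # t'" "count_list s One = count_list s' One"
  shows "s = s' \<and> t = t'"
  using assms by (auto simp: append_eq_append_conv2 Cons_eq_append_conv append_eq_Cons_conv)

text \<open>
  In \<open>s 1 q 0\<^sup>j r\<close>, the size of the left factor \<open>s 1 0\<^sup>j\<close> tells which letter \<open>1\<close> ends \<open>s 1\<close>.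
\<close>

lemma sharp_cancel:
  assumes "u \<in> dyck (Suc m)" "u' \<in> dyck (Suc m)" "bal v" "v \<noteq> []" "bal v'" "v' \<noteq> []"
    and eq: "u \<sharp> v = u' \<sharp> v'"
  shows "u = u' \<and> v = v'"
proof -
  have uu: "bal u" "u \<noteq> []" "bal u'" "u' \<noteq> []" using assms by (auto simp: dyck_iff)
  obtain s j where u: "u = s @ One # replicate (Suc j) Zero" using uu dyck_last_peak by blast
  obtain s' j' where u': "u' = s' @ One # replicate (Suc j') Zero" using uu dyck_last_peak by blast
  obtain q r where v: "v = One # q @ Zero # r" "bal q" "bal r" using assms dyck_first_return by blast
  obtain q' r' where v': "v' = One # q' @ Zero # r'" "bal q'" "bal r'"
    using assms dyck_first_return by blast
  have eq: "s @ One # q @ replicate (Suc j) Zero @ r = s' @ One # q' @ replicate (Suc j') Zero @ r'"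
    using eq sharp_eq uu u u' v v' by simp
  have "count_list (replicate k Zero) One = 0" for k
    by (induction k) auto
  then have "count_list s One = count_list s' One" using assms u u' by (auto simp: dyck_iff)
  then have ss: "s = s'" and *: "q @ replicate (Suc j) Zero @ r = q' @ replicate (Suc j') Zero @ r'"
    using prefix_One_cancel[OF eq] by auto
  have "length u = length u'" using assms length_dyck by metis
  then have j: "j = j'" using u u' ss by simp
  \<comment> \<open>The first of the \<open>Suc j\<close> zeros is the first step below the start of
    \<open>q\<close>, so it separates \<open>q\<close> from the rest.\<close>
  have "q = q' \<and> replicate j Zero @ r = replicate j' Zero @ r'"
    by (rule bal_cancel_left) (use * v v' in auto)
  then show ?thesis using u u' v v' ss j by simp
qed

section \<open>Steps of the dexter order\<close>

text \<open>A subpath is an arch: dropping its two end letters lowers the interior by one, which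
  turns strict positivity into \<open>above 0\<close>.\<close>

lemma subpath_word_iff: "subpath_word x \<longleftrightarrow> (\<exists>y. bal y \<and> x = One # y @ [Zero])"
proof
  assume x: "subpath_word x"
  then obtain a t where at: "x = a # t" by (cases x) (auto simp: subpath_word_def)
  have "t \<noteq> []" using x at by (cases a) (auto simp: subpath_word_def)
  then obtain y l where t: "t = y @ [l]" by (cases t rule: rev_cases) auto
  have *: "height (a # take k y) > 0" if "k \<le> length y" for k
    using x that at t unfolding subpath_word_def by (auto dest!: spec[of _ "Suc k"])
  have a: "a = One" using *[of 0] by (cases a) auto
  have "height (take k y) \<ge> 0" if "k \<le> length y" for k
    using *[OF that] a by simp
  then have "above 0 y" by (simp add: above_iff_take)
  moreover have "l = Zero" "height y = 0"
    using above_end[OF calculation] x at t a by (cases l; auto simp: subpath_word_def)+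
  ultimately show "\<exists>y. bal y \<and> x = One # y @ [Zero]" using at t a by (auto simp: bal_def)
next
  assume "\<exists>y. bal y \<and> x = One # y @ [Zero]"
  then obtain y where y: "bal y" "x = One # y @ [Zero]" by blast
  have "height (take k x) > 0" if "0 < k" "k < length x" for k
  proof (cases k)
    case (Suc k')
    then have "height (take k' y) \<ge> 0" "k' \<le> length y"
      using y that by (auto simp: bal_def above_iff_take)
    then show ?thesis using y Suc by simp
  qed (use that in simp)
  then show "subpath_word x" using y by (auto simp: subpath_word_def bal_def)
qed

text \<open>Edges without reference to the size. The zeros left in place belong to \<open>c\<close>;
  the \<open>Suc i\<close> zeros that are passed join the closing zero of the arch, which makes
  \<open>Suc (Suc i)\<close>.\<close>

definition step :: "word \<Rightarrow> word \<Rightarrow> bool" where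
  "step w v \<longleftrightarrow> (\<exists>c y i b. bal y \<and> (b = [] \<or> hd b = One) \<and>
     w = c @ replicate (Suc i) Zero @ One # y @ Zero # b \<and>
     v = c @ One # y @ replicate (Suc (Suc i)) Zero @ b)"

lemma stepI:
  assumes "bal y" "b = [] \<or> hd b = One"
    "w = c @ replicate (Suc i) Zero @ One # y @ Zero # b"
    "v = c @ One # y @ replicate (Suc (Suc i)) Zero @ b"
  shows "step w v"
  using assms unfolding step_def by blast

lemma stepE:
  assumes "step w v"
  obtains c y i b where "bal y" "b = [] \<or> hd b = One"
    "w = c @ replicate (Suc i) Zero @ One # y @ Zero # b"
    "v = c @ One # y @ replicate (Suc (Suc i)) Zero @ b"
  using assms unfolding step_def by blast

text \<open>The paths differ only between \<open>c\<close> and \<open>b\<close>, and there both have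
  the same lowest height, reached just before \<open>b\<close>. The equivalence allows intervals to
  be explored downwards from their maximum.\<close>

lemma step_dyck:
  assumes "step w v"
  shows "v \<in> dyck n \<longleftrightarrow> w \<in> dyck n"
proof -
  obtain c y i b where y: "bal y"
    and w: "w = c @ replicate (Suc i) Zero @ One # y @ Zero # b"
    and v: "v = c @ One # y @ replicate (Suc (Suc i)) Zero @ b"
    using assms by (rule stepE)
  have "height w = height v" unfolding v w by simp
  moreover have "above 0 v \<longleftrightarrow> above 0 w"
  proof
    assume "above 0 v"
    then show "above 0 w" using y unfolding v w by (auto simp: bal_def algebra_simps)
  next
    assume "above 0 w"
    then show "above 0 v" using y unfolding v w by (auto simp: bal_def algebra_simps)
  qed
  moreover have "count_list v One = count_list w One" unfolding v w by simp
  ultimately show ?thesis by (simp add: dyck_iff bal_def)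
qed

text \<open>The \<open>N - i\<close> unmoved zeros are absorbed into \<open>c\<close>. Conversely,
  splitting the trailing zeros off \<open>c\<close> restores the maximal run, of length
  \<open>k + Suc i\<close>.\<close>

lemma dexter_edges_iff: "(w, w') \<in> dexter_edges n \<longleftrightarrow> w \<in> dyck n \<and> step w w'"
proof
  assume "(w, w') \<in> dexter_edges n"
  then obtain a N x b i where h: "w \<in> dyck n" "w = a @ replicate N Zero @ x @ b"
    "subpath_word x" "b = [] \<or> hd b = One" "1 \<le> i" "i \<le> N"
    "w' = a @ replicate (N - i) Zero @ x @ replicate i Zero @ b"
    unfolding dexter_edges_def by blast
  obtain y where y: "bal y" "x = One # y @ [Zero]" using h by (auto simp: subpath_word_iff)
  obtain k where k: "i = Suc k" using h by (cases i) auto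
  have "replicate N Zero = replicate (N - i) Zero @ replicate i Zero"
    using h by (simp flip: replicate_add)
  then have "step w w'"
    using h y k by (intro stepI[of y b w "a @ replicate (N - i) Zero" k]) auto
  then show "w \<in> dyck n \<and> step w w'" using h by simp
next
  assume "w \<in> dyck n \<and> step w w'"
  then obtain c y i b where h: "w \<in> dyck n" "bal y" "b = [] \<or> hd b = One"
    "w = c @ replicate (Suc i) Zero @ One # y @ Zero # b"
    "w' = c @ One # y @ replicate (Suc (Suc i)) Zero @ b"
    by (auto elim: stepE)
  have "\<exists>a k. c = a @ replicate k Zero \<and> (a = [] \<or> last a \<noteq> Zero)"
  proof (induction c rule: rev_induct)
    case (snoc x c)
    show ?case
    proof (cases x)
      case Zero
      obtain a k where "c = a @ replicate k Zero" "a = [] \<or> last a \<noteq> Zero" using snoc by blast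
      then have "c @ [x] = a @ replicate (Suc k) Zero" "a = [] \<or> last a \<noteq> Zero"
        using Zero by (auto simp: replicate_append_same)
      then show ?thesis by blast
    next
      case One
      then have "c @ [x] = (c @ [x]) @ replicate 0 Zero" "last (c @ [x]) \<noteq> Zero" by auto
      then show ?thesis by blast
    qed
  qed simp
  then obtain a k where c: "c = a @ replicate k Zero" "a = [] \<or> last a \<noteq> Zero" by blast
  have "w = a @ replicate (k + Suc i) Zero @ (One # y @ [Zero]) @ b"
    "w' = a @ replicate (k + Suc i - Suc i) Zero @ (One # y @ [Zero]) @ replicate (Suc i) Zero @ b"
    using h c by (auto simp: replicate_add replicate_append_same)
  moreover have "subpath_word (One # y @ [Zero])" using h by (auto simp: subpath_word_iff)
  moreover have "k + Suc i \<ge> 1" "1 \<le> Suc i" "Suc i \<le> k + Suc i" by auto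
  ultimately show "(w, w') \<in> dexter_edges n"
    unfolding dexter_edges_def using h c by blast
qed

lemma dexter_le_iff: "dexter_le n u v \<longleftrightarrow> v \<in> dyck n \<and> step\<^sup>*\<^sup>* u v"
proof
  assume "dexter_le n u v"
  then have "(u, v) \<in> (dexter_edges n)\<^sup>*" "v \<in> dyck n" by (auto simp: dexter_le_def)
  then show "v \<in> dyck n \<and> step\<^sup>*\<^sup>* u v"
    by (induction rule: rtrancl_induct)
      (auto simp: dexter_edges_iff intro: rtranclp.rtrancl_into_rtrancl)
next
  assume "v \<in> dyck n \<and> step\<^sup>*\<^sup>* u v"
  then have "step\<^sup>*\<^sup>* u v" "v \<in> dyck n" by auto
  then show "dexter_le n u v"
    by (induction rule: converse_rtranclp_induct)
      (auto simp: dexter_le_def dexter_edges_iff step_dyck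
        intro: converse_rtrancl_into_rtrancl)
qed

section \<open>Locating the target of a step inside a product\<close>

lemma append_split:
  assumes "x @ y = p @ b"
  obtains us where "x = p @ us" "us @ y = b" | us where "p = x @ us" "y = us @ b"
  using assms by (auto simp: append_eq_append_conv2)

text \<open>If \<open>t\<close> began strictly inside the arch or among the zeros, it would be a
  suffix of \<open>y\<close> followed by zeros, or zeros only, hence of negative height. So the
  whole arch lies in \<open>t\<close>.\<close>

lemma suffix_above:
  assumes eq: "c @ One # y @ replicate (Suc k) Zero = s @ t"
    and "bal y" "t \<noteq> []" "above 0 t"
  obtains c' where "c = s @ c'" "t = c' @ One # y @ replicate (Suc k) Zero"
proof -
  have t0: "height t \<ge> 0" using assms above_end[of 0 t] by simp
  from eq show ?thesis
  proof (rule append_split)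
    fix us assume "c = s @ us" "us @ One # y @ replicate (Suc k) Zero = t"
    then show ?thesis using that by blast
  next
    fix us assume us: "s = c @ us" "One # y @ replicate (Suc k) Zero = us @ t"
    show ?thesis
    proof (cases us)
      case Nil
      then show ?thesis using that[of "[]"] us by simp
    next
      case (Cons x us')
      then have "y @ replicate (Suc k) Zero = us' @ t" using us by simp
      then have False
      proof (rule append_split)
        fix vs assume "y = us' @ vs" "vs @ replicate (Suc k) Zero = t"
        then show False using t0 bal_suffix[of us' vs] \<open>bal y\<close> by auto
      next
        fix vs assume "replicate (Suc k) Zero = vs @ t"
        then have "set vs \<union> set t = {Zero}" by (metis set_append set_replicate_Suc)
        then have "t = replicate (length t) Zero"
          by (intro replicate_eqI) (auto simp: set_eq_iff)
        then have "height t = - int (length t)" by (metis height_simps(5))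
        then show False using t0 \<open>t \<noteq> []\<close> by simp
      qed
      then show ?thesis ..
    qed
  qed
qed

text \<open>
  The block of zeros in \<open>c 1 y 0\<^sup>i\<^sup>+\<^sup>2 b\<close> ends a maximal run of zeros. In \<open>s 1 q 0\<^sup>j\<^sup>+\<^sup>1 r\<close> such a run
  ends in \<open>s\<close>, strictly inside \<open>q\<close>, in \<open>r\<close>, or with \<open>0\<^sup>j\<^sup>+\<^sup>1\<close>; in the last situation the subpath
  \<open>1 y 0\<close> may itself end among the zeros \<open>0\<^sup>j\<^sup>+\<^sup>1\<close> or in \<open>q\<close>.
\<close>

lemma step_cases:
  assumes eq: "s @ One # q @ replicate (Suc j) Zero @ r
      = c @ One # y @ replicate (Suc (Suc i)) Zero @ b"
    and q: "bal q" and r: "bal r" and y: "bal y" and b: "b = [] \<or> hd b = One"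
  obtains
    (left) b' where "s = c @ One # y @ replicate (Suc (Suc i)) Zero @ b'"
      "b' = [] \<or> hd b' = One" "b = b' @ One # q @ replicate (Suc j) Zero @ r"
  | (inner) c' b' where "c = s @ One # c'"
      "q = c' @ One # y @ replicate (Suc (Suc i)) Zero @ One # b'"
      "b = One # b' @ replicate (Suc j) Zero @ r"
  | (right) c' where "c = s @ One # q @ replicate (Suc j) Zero @ c'"
      "r = c' @ One # y @ replicate (Suc (Suc i)) Zero @ b"
  | (left_end) e m where "j = Suc (i + m)" "s @ [One] = c @ One # e"
      "y = e @ q @ replicate m Zero" "b = r"
  | (inner_end) c' m where "i = m + j" "c = s @ One # c'"
      "q = c' @ One # y @ replicate (Suc m) Zero" "b = r"
proof -
  let ?p = "c @ One # y @ replicate (Suc (Suc i)) Zero"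
  have last_p: "?p \<noteq> z @ [One]" for z
    by (metis last_appendR last_ConsR append_is_Nil_conv last_replicate last_snoc letter.distinct(1)
        list.distinct(1) nat.distinct(1) replicate_empty)
  \<comment> \<open>The end of \<open>?p\<close> is compared in turn with the ends of
    \<open>s 1\<close>, \<open>q\<close>, the run of zeros and \<open>r\<close>; \<open>t1\<close>,
    \<open>t2\<close>, \<open>t3\<close> are what remains of \<open>?p\<close>.\<close>
  have "(s @ [One]) @ (q @ replicate (Suc j) Zero @ r) = ?p @ b" using eq by simp
  then show ?thesis
  proof (rule append_split)
    fix us assume us: "s @ [One] = ?p @ us" "us @ q @ replicate (Suc j) Zero @ r = b"
    have "us \<noteq> []" using us(1) last_p by (metis append_Nil2)
    then obtain b' where b': "us = b' @ [One]" using us(1)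
      by (metis append_butlast_last_id last_appendR last_snoc)
    then have "b' = [] \<or> hd b' = One" using us b by (cases b') auto
    moreover have "s = ?p @ b'" using us b' by simp
    ultimately show ?thesis using left us b' by simp
  next
    fix t1 assume t1: "?p = (s @ [One]) @ t1" "q @ replicate (Suc j) Zero @ r = t1 @ b"
    have t1_ne: "t1 \<noteq> []" using t1(1) last_p by auto
    \<comment> \<open>The step ends with the run \<open>replicate (Suc j) Zero\<close>; comparing
      the lengths of the two runs gives the last two cases.\<close>
    have run_end: ?thesis if "t1 = q @ replicate (Suc j) Zero" "b = r"
    proof -
      have e: "s @ One # q @ replicate (Suc j) Zero = ?p" using that t1 by simp
      show ?thesis
      proof (cases "i < j")
        \<comment> \<open>All \<open>i + 2\<close> zeros of the step fit into the run; the remaining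
          \<open>m\<close> zeros close off the word \<open>y\<close>, and the arch must start no
          later than the \<open>One\<close> after \<open>s\<close>.\<close>
        case True
        then obtain m where m: "j = Suc (i + m)" using less_imp_Suc_add by blast
        have "replicate (Suc j) Zero = replicate m Zero @ replicate (Suc (Suc i)) Zero"
          using m by (simp flip: replicate_add replicate.simps)
        then have "(s @ One # q @ replicate m Zero) @ replicate (Suc (Suc i)) Zero
            = (c @ One # y) @ replicate (Suc (Suc i)) Zero" using e by simp
        then have "s @ One # q @ replicate m Zero = c @ One # y" by blast
        then have "(s @ [One]) @ (q @ replicate m Zero) = c @ One # y" by simp
        then show ?thesis
        proof (rule append_split)
          fix us assume us: "s @ [One] = c @ us" "us @ q @ replicate m Zero = One # y"
          show ?thesis
          proof (cases us)
            case Nil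
            then have "height (q @ replicate m Zero) = height (One # y)" using us by simp
            then show ?thesis using q y by (simp add: bal_def)
          next
            case (Cons x e)
            then show ?thesis using left_end[of m e] m us \<open>b = r\<close> by simp
          qed
        next
          fix us assume "c = (s @ [One]) @ us" and us: "q @ replicate m Zero = us @ One # y"
          from us have False
          proof (rule append_split)
            fix vs assume vs: "q = us @ vs" "vs @ replicate m Zero = One # y"
            have "height vs - int m = 1 + height y" using arg_cong[OF vs(2), of height] by simp
            then show False using bal_suffix[of us vs] q y vs(1) by (simp add: bal_def)
          next
            fix vs assume "replicate m Zero = vs @ One # y"
            then have "One \<in> set (replicate m Zero)" by simp
            then show False by simp
          qed
          then show ?thesis ..
        qed
      next
        \<comment> \<open>The step uses up the whole run, and \<open>m + 1\<close> further zeros end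
          \<open>q\<close>; by \<open>suffix_above\<close> the arch then lies in
          \<open>q\<close>.\<close>
        case False
        then obtain m where m: "i = m + j" by (metis add.commute le_iff_add not_less)
        have "replicate (Suc (Suc i)) Zero = replicate (Suc m) Zero @ replicate (Suc j) Zero"
          using m by (simp flip: replicate_add replicate.simps)
        then have "(s @ One # q) @ replicate (Suc j) Zero
            = (c @ One # y @ replicate (Suc m) Zero) @ replicate (Suc j) Zero" using e by simp
        then have *: "s @ One # q = c @ One # y @ replicate (Suc m) Zero" by blast
        have "q \<noteq> []"
        proof
          assume "q = []"
          then have "last (c @ One # y @ replicate (Suc m) Zero) = One"
            using * by (metis last_snoc)
          then show False by (simp flip: replicate_append_same)
        qed
        moreover have "c @ One # y @ replicate (Suc m) Zero = (s @ [One]) @ q" using * by simp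
        ultimately obtain c' where "c = (s @ [One]) @ c'" "q = c' @ One # y @ replicate (Suc m) Zero"
          using suffix_above[of c y m "s @ [One]" q] q y by (auto simp: bal_def)
        then show ?thesis using inner_end[of m c'] m \<open>b = r\<close> by simp
      qed
    qed
    from t1(2) show ?thesis
    proof (rule append_split)
      fix us assume us: "q = t1 @ us" "us @ replicate (Suc j) Zero @ r = b"
      have "above 0 t1" using us q by (simp add: bal_def)
      then obtain c' where c': "c = (s @ [One]) @ c'" "t1 = c' @ One # y @ replicate (Suc (Suc i)) Zero"
        using suffix_above[of c y "Suc i" "s @ [One]" t1] t1 t1_ne y by blast
      \<comment> \<open>With \<open>us\<close> empty, \<open>b\<close> would begin with
        \<open>Zero\<close>.\<close>
      have "us \<noteq> []" "hd us = One" using us b by (cases us; auto)+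
      then obtain b' where "us = One # b'" by (cases us) auto
      then show ?thesis using inner[of c' b'] c' us by simp
    next
      fix t2 assume t2: "t1 = q @ t2" "replicate (Suc j) Zero @ r = t2 @ b"
      from t2(2) show ?thesis
      proof (rule append_split)
        fix us assume us: "replicate (Suc j) Zero = t2 @ us" "us @ r = b"
        \<comment> \<open>Stopping inside the run would again make \<open>b\<close> begin with
          \<open>Zero\<close>.\<close>
        have "us = []"
        proof (cases us)
          case (Cons x us')
          then have "x \<in> set (replicate (Suc j) Zero)" using us by simp
          then show ?thesis using us b Cons by auto
        qed
        then show ?thesis using run_end us t2 by simp
      next
        fix t3 assume t3: "t2 = replicate (Suc j) Zero @ t3" "r = t3 @ b"
        show ?thesis
        proof (cases "t3 = []")
          case True
          then show ?thesis using run_end t3 t2 by simp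
        next
          case False
          have "above 0 t3" using t3 r by (simp add: bal_def)
          moreover have "?p = (s @ One # q @ replicate (Suc j) Zero) @ t3" using t1 t2 t3 by simp
          ultimately obtain c' where "c = (s @ One # q @ replicate (Suc j) Zero) @ c'"
              "t3 = c' @ One # y @ replicate (Suc (Suc i)) Zero"
            using suffix_above[of c y "Suc i" "s @ One # q @ replicate (Suc j) Zero" t3] False y
            by blast
          then show ?thesis using right[of c'] t3 by simp
        qed
      qed
    qed
  qed
qed

section \<open>Steps and products\<close>

text \<open>Either the arch and the zeros precede the last peak of \<open>u\<close> and are
  untouched by the product, or the arch contains that peak and the product inserts \<open>q\<close>
  into it.\<close>

lemma step_sharp_left:
  assumes "step u' u" and u: "bal u" "u \<noteq> []" and v: "bal v" "v \<noteq> []"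
  shows "step (u' \<sharp> v) (u \<sharp> v)"
proof -
  have u': "bal u'" using step_dyck[OF assms(1)] u by (metis dyck_iff)
  obtain s j where us: "u = s @ One # replicate (Suc j) Zero" using u dyck_last_peak by blast
  obtain q r where v: "v = One # q @ Zero # r" "bal q" "bal r" using v dyck_first_return by blast
  obtain c y i b where y: "bal y" and b: "b = [] \<or> hd b = One"
    and w: "u' = c @ replicate (Suc i) Zero @ One # y @ Zero # b"
    and uc: "u = c @ One # y @ replicate (Suc (Suc i)) Zero @ b"
    using assms(1) by (rule stepE)
  have uv: "u \<sharp> v = s @ One # q @ replicate (Suc j) Zero @ r"
    using sharp_eq u v us by blast
  \<comment> \<open>Reading \<open>u\<close> with empty \<open>q\<close> and \<open>r\<close> lets
    \<open>step_cases\<close> classify its own steps.\<close>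
  have "s @ One # [] @ replicate (Suc j) Zero @ [] = c @ One # y @ replicate (Suc (Suc i)) Zero @ b"
    using us uc by simp
  from this bal_Nil bal_Nil y b show ?thesis
  proof (cases rule: step_cases)
    case (left b')
    have "u' = (c @ replicate (Suc i) Zero @ One # y @ Zero # b') @ One # replicate (Suc j) Zero"
      using w left by simp
    then have "u' \<sharp> v = c @ replicate (Suc i) Zero @ One # y @ Zero # b' @ One # q @ replicate (Suc j) Zero @ r"
      using sharp_eq[of "c @ replicate (Suc i) Zero @ One # y @ Zero # b'"] u' v by simp
    then show ?thesis
      using y left uv
      by (intro stepI[of y "b' @ One # q @ replicate (Suc j) Zero @ r" _ c i]) (auto simp: hd_append)
  next
    case (left_end e m)
    obtain e' where e': "One # e = e' @ [One]"
      using left_end(2) by (metis append_butlast_last_id last_appendR last_snoc list.distinct(1))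
    then have s: "s = c @ e'" using left_end(2) by simp
    have e'': "One # e @ x = e' @ One # x" for x using e' by (metis append_Cons append.assoc append_Nil)
    have z: "replicate (Suc j) Zero @ x = replicate m Zero @ replicate (Suc (Suc i)) Zero @ x" for x
      using left_end(1) by (simp flip: replicate_add replicate.simps append_assoc)
    have "u' = (c @ replicate (Suc i) Zero @ e') @ One # replicate (Suc m) Zero"
      using w left_end e'' by (simp add: replicate_append_same)
    then have "u' \<sharp> v = c @ replicate (Suc i) Zero @ e' @ One # q @ replicate (Suc m) Zero @ r"
      using sharp_eq[of "c @ replicate (Suc i) Zero @ e'" m] u' v by simp
    also have "\<dots> = c @ replicate (Suc i) Zero @ One # (e @ q @ replicate m Zero) @ Zero # r"
      using e'' by (simp add: replicate_app_Cons_same)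
    finally have 1: "u' \<sharp> v = c @ replicate (Suc i) Zero @ One # (e @ q @ replicate m Zero) @ Zero # r" .
    have "u \<sharp> v = c @ One # (e @ q @ replicate m Zero) @ replicate (Suc (Suc i)) Zero @ r"
      unfolding uv s z using e'' by simp
    \<comment> \<open>As \<open>e\<close> followed by \<open>m\<close> zeros is balanced,
      \<open>q\<close> is inserted at height \<open>m\<close>.\<close>
    moreover have "bal (e @ q @ replicate m Zero)"
      using y left_end(3) v(2) above_mono[of 0 q "int m"] by (auto simp: bal_def algebra_simps)
    ultimately show ?thesis using 1 bal_hd[OF v(3)] stepI by blast
  qed (use y in auto)
qed

lemma step_sharp_right:
  assumes "step v' v" and u: "bal u" "u \<noteq> []" and v: "bal v" "v \<noteq> []"
  shows "step (u \<sharp> v') (u \<sharp> v)"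
proof -
  have v': "bal v'" using step_dyck[OF assms(1)] v by (metis dyck_iff)
  obtain s j where us: "u = s @ One # replicate (Suc j) Zero" using u dyck_last_peak by blast
  obtain q r where vq: "v = One # q @ Zero # r" "bal q" "bal r" using v dyck_first_return by blast
  obtain c y i b where y: "bal y" and b: "b = [] \<or> hd b = One"
    and w: "v' = c @ replicate (Suc i) Zero @ One # y @ Zero # b"
    and vc: "v = c @ One # y @ replicate (Suc (Suc i)) Zero @ b"
    using assms(1) by (rule stepE)
  have uv: "u \<sharp> v = s @ One # q @ replicate (Suc j) Zero @ r"
    using sharp_eq u vq us by blast
  have sharp: "u \<sharp> (One # q' @ Zero # r') = s @ One # q' @ replicate (Suc j) Zero @ r'"
    if "bal q'" "bal r'" for q' r'
    using sharp_eq that us u by blast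
  \<comment> \<open>Reading \<open>v\<close> with empty \<open>s\<close> and a single zero leaves
    only the cases that concern \<open>q\<close> and \<open>r\<close>.\<close>
  have "[] @ One # q @ replicate (Suc 0) Zero @ r = c @ One # y @ replicate (Suc (Suc i)) Zero @ b"
    using vq vc by simp
  from this vq(2,3) y b show ?thesis
  proof (cases rule: step_cases)
    case (inner c' b')
    have "bal (c' @ replicate (Suc i) Zero @ One # y @ Zero # One # b')"
      using vq(2) y inner(2) by (auto simp: bal_def algebra_simps)
    then have "u \<sharp> v' = s @ One # (c' @ replicate (Suc i) Zero @ One # y @ Zero # One # b')
        @ replicate (Suc j) Zero @ r"
      using sharp[of "c' @ replicate (Suc i) Zero @ One # y @ Zero # One # b'" r] w inner vq(3) by simp
    then show ?thesis using uv inner y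
      by (intro stepI[of y "One # b' @ replicate (Suc j) Zero @ r" _ "s @ One # c'" i]) auto
  next
    case (right c')
    have "bal (c' @ replicate (Suc i) Zero @ One # y @ Zero # b)"
      using vq(3) y right(2) by (auto simp: bal_def algebra_simps)
    then have "u \<sharp> v' = s @ One # q @ replicate (Suc j) Zero
        @ c' @ replicate (Suc i) Zero @ One # y @ Zero # b"
      using sharp[of q "c' @ replicate (Suc i) Zero @ One # y @ Zero # b"] w right vq(2) by simp
    then show ?thesis using uv right y b
      by (intro stepI[of y b _ "s @ One # q @ replicate (Suc j) Zero @ c'" i]) auto
  next
    \<comment> \<open>The arch leaves \<open>q\<close>: in \<open>v'\<close> the first return
      follows \<open>c' @ replicate m Zero\<close>, and the arch is prepended to
      \<open>r\<close>.\<close>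
    case (inner_end c' m)
    have z: "replicate (Suc m) Zero @ replicate (Suc j) Zero @ x = replicate (Suc (Suc (m + j))) Zero @ x"
      "replicate m Zero @ replicate (Suc j) Zero @ x = replicate (Suc (m + j)) Zero @ x" for x
      by (simp_all add: replicate_add replicate_app_Cons_same)
    have r: "bal (One # y @ Zero # r)" using y vq(3) by (auto simp: bal_def)
    have "bal (c' @ replicate m Zero)"
      using vq(2) y inner_end(3) by (auto simp: bal_def algebra_simps)
    then have "u \<sharp> v' = s @ One # (c' @ replicate m Zero) @ replicate (Suc j) Zero @ One # y @ Zero # r"
      using sharp[of "c' @ replicate m Zero" "One # y @ Zero # r"] w inner_end r
      by (simp add: replicate_app_Cons_same)
    then have "u \<sharp> v' = s @ One # c' @ replicate (Suc (m + j)) Zero @ One # y @ Zero # r"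
      using z by (simp del: replicate.simps)
    moreover have "u \<sharp> v = s @ One # c' @ One # y @ replicate (Suc (Suc (m + j))) Zero @ r"
      using uv inner_end(3) z by (simp del: replicate.simps)
    ultimately show ?thesis using bal_hd[OF vq(3)] y
      by (intro stepI[of y r _ "s @ One # c'" "m + j"]) auto
  qed auto
qed

text \<open>Each position in \<open>step_cases\<close> is traced back to one factor:
  \<open>left\<close> and \<open>left_end\<close> to \<open>u\<close>, the other three to
  \<open>v\<close>.\<close>

lemma step_sharpE:
  assumes "step w (u \<sharp> v)" and u: "bal u" "u \<noteq> []" and v: "bal v" "v \<noteq> []"
  obtains (left) u' where "step u' u" "w = u' \<sharp> v" | (right) v' where "step v' v" "w = u \<sharp> v'"
proof -
  obtain s j where us: "u = s @ One # replicate (Suc j) Zero" using u dyck_last_peak by blast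
  obtain q r where vq: "v = One # q @ Zero # r" "bal q" "bal r" using v dyck_first_return by blast
  have uv: "u \<sharp> v = s @ One # q @ replicate (Suc j) Zero @ r"
    using sharp_eq u vq us by blast
  have sharp_left: "u' \<sharp> v = s' @ One # q @ replicate (Suc j') Zero @ r"
    if "step u' u" "u' = s' @ One # replicate (Suc j') Zero" for u' s' j'
  proof -
    have "bal u'" using step_dyck[OF that(1)] u by (metis dyck_iff)
    then show ?thesis using sharp_eq that vq by blast
  qed
  have sharp_right: "u \<sharp> (One # q' @ Zero # r') = s @ One # q' @ replicate (Suc j) Zero @ r'"
    if "bal q'" "bal r'" for q' r'
    using sharp_eq that us u by blast
  obtain c y i b where y: "bal y" and b: "b = [] \<or> hd b = One"
    and w: "w = c @ replicate (Suc i) Zero @ One # y @ Zero # b"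
    and uc: "u \<sharp> v = c @ One # y @ replicate (Suc (Suc i)) Zero @ b"
    using assms(1) by (rule stepE)
  from uc[unfolded uv] vq(2,3) y b show ?thesis
  proof (cases rule: step_cases)
    case L: (left b')
    let ?s = "c @ replicate (Suc i) Zero @ One # y @ Zero # b'"
    have "step (?s @ One # replicate (Suc j) Zero) u"
      using L us y by (intro stepI[of y "b' @ One # replicate (Suc j) Zero" _ c i]) (auto simp: hd_append)
    then show ?thesis using left sharp_left L w by fastforce
  next
    case (inner c' b')
    let ?q = "c' @ replicate (Suc i) Zero @ One # y @ Zero # One # b'"
    have "bal ?q" using vq(2) y inner(2) by (auto simp: bal_def algebra_simps)
    then have "w = u \<sharp> (One # ?q @ Zero # r)" using sharp_right[of ?q r] w inner vq(3) by simp
    moreover have "step (One # ?q @ Zero # r) v"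
      using inner vq y by (intro stepI[of y "One # b' @ Zero # r" _ "One # c'" i]) auto
    ultimately show ?thesis using right by blast
  next
    case R: (right c')
    let ?r = "c' @ replicate (Suc i) Zero @ One # y @ Zero # b"
    have "bal ?r" using vq(3) y R(2) by (auto simp: bal_def algebra_simps)
    then have "w = u \<sharp> (One # q @ Zero # ?r)" using sharp_right[of q ?r] w R vq(2) by simp
    moreover have "step (One # q @ Zero # ?r) v"
      using R vq y b by (intro stepI[of y b _ "One # q @ Zero # c'" i]) auto
    ultimately show ?thesis using right by blast
  next
    \<comment> \<open>Deleting the inserted \<open>q\<close> from the arch content
      \<open>e q 0^m\<close> gives the arch of a step into \<open>u\<close>.\<close>
    case (left_end e m)
    obtain e' where e': "One # e = e' @ [One]"
      using left_end(2) by (metis append_butlast_last_id last_appendR last_snoc list.distinct(1))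
    then have s: "s = c @ e'" using left_end(2) by simp
    have e'': "One # e @ x = e' @ One # x" for x using e' by (metis append_Cons append.assoc append_Nil)
    have z: "replicate (Suc j) Zero = replicate m Zero @ replicate (Suc (Suc i)) Zero"
      using left_end(1) by (simp flip: replicate_add replicate.simps)
    let ?u = "(c @ replicate (Suc i) Zero @ e') @ One # replicate (Suc m) Zero"
    have "bal (e @ replicate m Zero)"
      using y left_end(3) vq(2) by (auto simp: bal_def algebra_simps)
    moreover have "?u = c @ replicate (Suc i) Zero @ One # (e @ replicate m Zero) @ Zero # []"
      using e'' by (simp add: replicate_append_same)
    moreover have "u = c @ One # (e @ replicate m Zero) @ replicate (Suc (Suc i)) Zero @ []"
      unfolding us s z using e'' by simp
    ultimately have *: "step ?u u" using stepI by blast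
    have "?u \<sharp> v = (c @ replicate (Suc i) Zero @ e') @ One # q @ replicate (Suc m) Zero @ r"
      by (rule sharp_left[OF * refl])
    also have "\<dots> = w"
      unfolding w using left_end(3,4) e'' by (simp add: replicate_app_Cons_same)
    finally show ?thesis using left * by simp
  next
    \<comment> \<open>The arch passes \<open>m + j + 1\<close> zeros in the product but only
      \<open>m + 1\<close> in \<open>v\<close>; the other \<open>j\<close> come from the run of
      \<open>u\<close>.\<close>
    case (inner_end c' m)
    have z: "replicate m Zero @ replicate (Suc j) Zero @ x = replicate (Suc i) Zero @ x" for x
      using inner_end(1) by (simp add: replicate_add replicate_app_Cons_same)
    let ?q = "c' @ replicate m Zero" and ?r = "One # y @ Zero # r"
    have "bal ?q" using vq(2) y inner_end(3) by (auto simp: bal_def algebra_simps)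
    moreover have "bal ?r" using y vq(3) by (auto simp: bal_def)
    ultimately have "u \<sharp> (One # ?q @ Zero # ?r) = w"
      using sharp_right[of ?q ?r] w inner_end z by (simp del: replicate.simps)
    moreover have "step (One # ?q @ Zero # ?r) v"
      using inner_end vq y bal_hd[OF vq(3)]
      by (intro stepI[of y r _ "One # c'" m]) (auto simp: replicate_app_Cons_same)
    ultimately show ?thesis using right by blast
  qed
qed

lemma dexter_le_sharp:
  assumes "dexter_le (Suc m) u u'" "dexter_le (Suc n) v v'"
  shows "dexter_le (Suc (m + n)) (u \<sharp> v) (u' \<sharp> v')"
proof -
  have d: "u \<in> dyck (Suc m)" "u' \<in> dyck (Suc m)" "v \<in> dyck (Suc n)" "v' \<in> dyck (Suc n)"
    using assms by (auto simp: dexter_le_def)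
  then have v: "bal v" "v \<noteq> []" and u': "bal u'" "u' \<noteq> []" by (auto simp: dyck_iff)
  have uu: "step\<^sup>*\<^sup>* u u'" and vv: "step\<^sup>*\<^sup>* v v'" using assms by (auto simp: dexter_le_iff)
  from uu d(2) have "step\<^sup>*\<^sup>* (u \<sharp> v) (u' \<sharp> v)"
  proof (induction rule: rtranclp_induct)
    case (step x x')
    then have "x \<in> dyck (Suc m)" by (simp add: step_dyck)
    then show ?case
      using step step_sharp_left[of x x' v] v
      by (fastforce simp: dyck_iff intro: rtranclp.rtrancl_into_rtrancl)
  qed simp
  moreover from vv d(4) have "step\<^sup>*\<^sup>* (u' \<sharp> v) (u' \<sharp> v')"
  proof (induction rule: rtranclp_induct)
    case (step x x')
    then have "x \<in> dyck (Suc n)" by (simp add: step_dyck)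
    then show ?case
      using step step_sharp_right[of x x' u'] u'
      by (fastforce simp: dyck_iff intro: rtranclp.rtrancl_into_rtrancl)
  qed simp
  ultimately show ?thesis using sharp_dyck d by (simp add: dexter_le_iff)
qed

text \<open>Descending from the top, every step lowers one of the two factors by
  \<open>step_sharpE\<close>.\<close>

lemma below_sharpE:
  assumes "step\<^sup>*\<^sup>* w (u' \<sharp> v')" "u' \<in> dyck (Suc m)" "v' \<in> dyck (Suc n)"
  obtains u v where "w = u \<sharp> v" "dexter_le (Suc m) u u'" "dexter_le (Suc n) v v'"
proof -
  from assms(1) have "\<exists>u v. w = u \<sharp> v \<and> dexter_le (Suc m) u u' \<and> dexter_le (Suc n) v v'"
  proof (induction rule: converse_rtranclp_induct)
    case base
    then show ?case using assms by (auto simp: dexter_le_iff)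
  next
    case (step w x)
    then obtain u v where uv: "x = u \<sharp> v" "dexter_le (Suc m) u u'" "dexter_le (Suc n) v v'" by blast
    then have "bal u" "u \<noteq> []" "bal v" "v \<noteq> []" by (auto simp: dexter_le_def dyck_iff)
    with step(1)[unfolded uv(1)] show ?case
    proof (cases rule: step_sharpE)
      case (left u'')
      then have "dexter_le (Suc m) u'' u'"
        using uv by (auto simp: dexter_le_iff intro: converse_rtranclp_into_rtranclp)
      then show ?thesis using left uv by blast
    next
      case (right v'')
      then have "dexter_le (Suc n) v'' v'"
        using uv by (auto simp: dexter_le_iff intro: converse_rtranclp_into_rtranclp)
      then show ?thesis using right uv by blast
    qed
  qed
  then show ?thesis using that by blast
qed

section \<open>Factorisation into generators\<close>

definition max_generator :: "word \<Rightarrow> bool" where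
  "max_generator g \<longleftrightarrow> g = [One, Zero, One, Zero] \<or> (\<exists>w. bal w \<and> g = [One] @ w @ [One, Zero, Zero])"

lemma sharp_1010:
  assumes "bal u" "u \<noteq> []"
  shows "u \<sharp> [One, Zero, One, Zero] = u @ [One, Zero]"
proof -
  obtain s j where u: "u = s @ One # replicate (Suc j) Zero" using assms dyck_last_peak by blast
  have "bal [One, Zero]" by (simp add: bal_def)
  then show ?thesis using sharp_eq[of s j "[]" "[One, Zero]"] assms u by simp
qed

text \<open>Here \<open>sharp_eq\<close> applies with \<open>q\<close> equal to \<open>w 1 0\<close>
  and \<open>r\<close> empty, so the zero ending \<open>q\<close> lengthens the run by one.\<close>

lemma sharp_1w100:
  assumes "bal (s @ One # replicate (Suc j) Zero)" "bal w"
  shows "(s @ One # replicate (Suc j) Zero) \<sharp> ([One] @ w @ [One, Zero, Zero])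
    = s @ One # w @ One # replicate (Suc (Suc j)) Zero"
proof -
  have "bal (w @ [One, Zero])" using assms by (simp add: bal_def)
  then show ?thesis using sharp_eq[of s j "w @ [One, Zero]" "[]"] assms by simp
qed

lemma dyck_right_factor:
  assumes v: "v \<in> dyck (Suc (Suc n))"
  obtains m k u g where "v = u \<sharp> g" "u \<in> dyck (Suc m)" "g \<in> dyck (Suc (Suc k))" "max_generator g"
proof -
  have z: "count_list (replicate k Zero) One = 0" for k
    by (induction k) auto
  have v': "bal v" "v \<noteq> []" using v by (auto simp: dyck_iff)
  then obtain s j where s: "v = s @ One # replicate (Suc j) Zero" using dyck_last_peak by blast
  show ?thesis
  proof (cases j)
    case 0
    then have u: "s \<in> dyck (Suc n)" using s v z by (auto simp: dyck_iff bal_def)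
    then have "bal s" "s \<noteq> []" by (auto simp: dyck_iff)
    then have "v = s \<sharp> [One, Zero, One, Zero]" using sharp_1010[of s] s 0 by simp
    moreover have "[One, Zero, One, Zero] \<in> dyck (Suc (Suc 0))" by (auto simp: dyck_iff bal_def)
    ultimately show ?thesis using that u unfolding max_generator_def by blast
  next
    case (Suc i)
    \<comment> \<open>Before its last peak the path is at height \<open>j\<close>; the last ascent
      to that height marks the start of \<open>w\<close>.\<close>
    then have "height s > 0" using s v' by (auto simp: bal_def)
    then obtain s' w where sw: "s = s' @ One # w" "bal w" using positive_height_split by blast
    let ?u = "s' @ One # replicate (Suc i) Zero" and ?g = "[One] @ w @ [One, Zero, Zero]"
    have u: "bal ?u" using v' s sw Suc by (auto simp: bal_def)
    then have "v = ?u \<sharp> ?g" using sharp_1w100[of s' i w] sw s Suc by simp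
    moreover have "?u \<in> dyck (Suc (count_list s' One))" using u z by (simp add: dyck_iff)
    moreover have "?g \<in> dyck (Suc (Suc (count_list w One)))"
      using sw by (auto simp: dyck_iff bal_def)
    moreover have "max_generator ?g" using sw unfolding max_generator_def by blast
    ultimately show ?thesis using that by blast
  qed
qed

text \<open>A product with \<open>1010\<close> ends in \<open>10\<close>, one with
  \<open>1w100\<close> ends in \<open>00\<close>. In the latter case the length of the final run
  gives \<open>j\<close>, and cancelling that run leaves \<open>s 1 w\<close>, where
  \<open>bal_cancel_right\<close> recovers \<open>w\<close>.\<close>

lemma max_generator_unique:
  assumes "bal u" "u \<noteq> []" "bal u'" "u' \<noteq> []" "max_generator g" "max_generator g'"
    and eq: "u \<sharp> g = u' \<sharp> g'"
  shows "g = g'"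
proof -
  have mixed: False
    if h: "bal u" "u \<noteq> []" "bal u'" "u' \<noteq> []" "bal w"
      "u \<sharp> [One, Zero, One, Zero] = u' \<sharp> ([One] @ w @ [One, Zero, Zero])" for u u' w
  proof -
    obtain s j where u: "u' = s @ One # replicate (Suc j) Zero" using h dyck_last_peak by blast
    have "u @ [One, Zero] = s @ One # w @ One # replicate (Suc (Suc j)) Zero"
      using h sharp_1010[of u] sharp_1w100[of s j w] u by simp
    also have "\<dots> = (s @ One # w @ One # replicate j Zero) @ [Zero, Zero]"
      by (simp add: replicate_app_Cons_same)
    finally show False by simp
  qed
  have deep: "w = w'"
    if h: "bal w" "bal w'" "u \<sharp> ([One] @ w @ [One, Zero, Zero]) = u' \<sharp> ([One] @ w' @ [One, Zero, Zero])"
    for w w'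
  proof -
    obtain s j where u: "u = s @ One # replicate (Suc j) Zero" using assms dyck_last_peak by blast
    obtain s' j' where u': "u' = s' @ One # replicate (Suc j') Zero" using assms dyck_last_peak by blast
    have eq: "(s @ One # w) @ One # replicate (Suc (Suc j)) Zero
        = (s' @ One # w') @ One # replicate (Suc (Suc j')) Zero"
      using h assms sharp_1w100[of s j w] sharp_1w100[of s' j' w'] u u' by simp
    have "trailing_zeros ((s @ One # w) @ One # replicate (Suc (Suc j)) Zero) = Suc (Suc j)"
      "trailing_zeros ((s' @ One # w') @ One # replicate (Suc (Suc j')) Zero) = Suc (Suc j')"
      by (rule trailing_zeros_One)+
    then have "j = j'" using eq by (metis nat.inject)
    then have "s @ One # w = s' @ One # w'" using eq by simp
    then show ?thesis using bal_cancel_right h by blast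
  qed
  show ?thesis
    using assms(5,6) eq mixed[OF assms(1-4)] mixed[OF assms(3,4,1,2)] deep
    unfolding max_generator_def by metis
qed

text \<open>The target of a step contains two consecutive zeros, which \<open>1010\<close> does
  not.\<close>

lemma below_1010:
  assumes "step\<^sup>*\<^sup>* u [One, Zero, One, Zero]"
  shows "u = [One, Zero, One, Zero]"
proof -
  have "\<not> step w [One, Zero, One, Zero]" for w
    by (auto simp: step_def Cons_eq_append_conv append_eq_Cons_conv)
  then show ?thesis using assms by (metis rtranclp.cases)
qed

section \<open>The monoid of intervals and its freeness\<close>

lemma carrier_M2: "(u, v) \<in> carrier M2 \<longleftrightarrow> (\<exists>n. dexter_le (Suc n) u v)"
proof -
  have "(u, v) \<in> carrier M2 \<longleftrightarrow> (\<exists>n\<ge>1. dexter_le n u v)" by (auto simp: M2_def)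
  also have "\<dots> \<longleftrightarrow> (\<exists>n. dexter_le (Suc n) u v)"
    by (metis One_nat_def Suc_le_D Suc_le_mono zero_le)
  finally show ?thesis .
qed

lemma mult_M2: "(u, u') \<otimes>\<^bsub>M2\<^esub> (v, v') = (u \<sharp> v, u' \<sharp> v')"
  by (simp add: M2_def)

lemma one_M2: "\<one>\<^bsub>M2\<^esub> = ([One, Zero], [One, Zero])"
  by (simp add: M2_def)

lemma carrier_M2_bal:
  assumes "(u, v) \<in> carrier M2"
  shows "bal u \<and> u \<noteq> [] \<and> bal v \<and> v \<noteq> []"
  using assms by (auto simp: carrier_M2 dexter_le_def dyck_iff)

text \<open>Treats both kinds of generators by their maximum alone, since by
  \<open>below_1010\<close> the only interval with maximum \<open>1010\<close> is the trivial
  one.\<close>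

lemma generators_iff:
  "(u, v) \<in> M2_generators \<longleftrightarrow> max_generator v \<and> (\<exists>n. dexter_le (Suc (Suc n)) u v)"
proof
  assume g: "(u, v) \<in> M2_generators"
  show "max_generator v \<and> (\<exists>n. dexter_le (Suc (Suc n)) u v)"
  proof (cases "(u, v) = ([One, Zero, One, Zero], [One, Zero, One, Zero])")
    case True
    then have "max_generator v" "dexter_le (Suc (Suc 0)) u v"
      by (auto simp: max_generator_def dexter_le_iff dyck_iff bal_def)
    then show ?thesis by blast
  next
    case False
    then obtain m w where w: "(u, v) \<in> carrier M2" "w \<in> dyck m" "v = [One] @ w @ [One, Zero, Zero]"
      using g unfolding M2_generators_def by blast
    then obtain n where n: "dexter_le (Suc n) u v" by (auto simp: carrier_M2)
    then have "n \<noteq> 0" using w by (auto simp: dexter_le_def dyck_iff)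
    then obtain k where "n = Suc k" by (cases n) auto
    then show ?thesis using n w by (auto simp: max_generator_def dyck_iff)
  qed
next
  assume g: "max_generator v \<and> (\<exists>n. dexter_le (Suc (Suc n)) u v)"
  then have c: "(u, v) \<in> carrier M2" by (auto simp: carrier_M2)
  show "(u, v) \<in> M2_generators"
  proof (cases "v = [One, Zero, One, Zero]")
    case True
    then show ?thesis using g below_1010[of u] by (auto simp: M2_generators_def dexter_le_iff)
  next
    case False
    then show ?thesis using g c unfolding M2_generators_def max_generator_def
      by (auto simp: dyck_iff)
  qed
qed

lemma monoid_M2: "monoid M2"
proof (rule monoidI)
  fix x y assume "x \<in> carrier M2" "y \<in> carrier M2"
  then show "x \<otimes>\<^bsub>M2\<^esub> y \<in> carrier M2"
    using dexter_le_sharp by (cases x; cases y) (auto simp: carrier_M2 mult_M2, blast)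
next
  show "\<one>\<^bsub>M2\<^esub> \<in> carrier M2"
    by (auto simp: one_M2 carrier_M2 dexter_le_iff dyck_iff bal_def intro!: exI[of _ 0])
next
  fix x y z assume "x \<in> carrier M2" "y \<in> carrier M2" "z \<in> carrier M2"
  then show "x \<otimes>\<^bsub>M2\<^esub> y \<otimes>\<^bsub>M2\<^esub> z = x \<otimes>\<^bsub>M2\<^esub> (y \<otimes>\<^bsub>M2\<^esub> z)"
    using sharp_assoc by (cases x; cases y; cases z) (auto simp: mult_M2 dest!: carrier_M2_bal)
next
  fix x assume "x \<in> carrier M2"
  then show "\<one>\<^bsub>M2\<^esub> \<otimes>\<^bsub>M2\<^esub> x = x" "x \<otimes>\<^bsub>M2\<^esub> \<one>\<^bsub>M2\<^esub> = x"
    using sharp_unit_left sharp_unit_right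
    by (cases x; auto simp: mult_M2 one_M2 dest!: carrier_M2_bal)+
qed

text \<open>Splitting off last factors terminates because \<open>size\<close> drops, which gives
  surjectivity. For injectivity, last factors are compared one at a time; \<open>one\<close>
  excludes that one word runs out before the other.\<close>

lemma free_monoid_onI:
  fixes M (structure) and size :: "'a \<Rightarrow> nat"
  assumes M: "monoid M" and S: "S \<subseteq> carrier M"
    and factor: "\<And>x. x \<in> carrier M \<Longrightarrow> x \<noteq> \<one> \<Longrightarrow>
      \<exists>y\<in>carrier M. \<exists>g\<in>S. x = y \<otimes> g \<and> size y < size x"
    and one: "\<And>y g. y \<in> carrier M \<Longrightarrow> g \<in> S \<Longrightarrow> y \<otimes> g \<noteq> \<one>"
    and unique: "\<And>y g y' g'. y \<in> carrier M \<Longrightarrow> g \<in> S \<Longrightarrow> y' \<in> carrier M \<Longrightarrow> g' \<in> S \<Longrightarrow>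
      y \<otimes> g = y' \<otimes> g' \<Longrightarrow> y = y' \<and> g = g'"
  shows "free_monoid_on M S"
proof -
  interpret monoid M by (rule M)
  let ?p = "\<lambda>xs. foldr (\<otimes>) xs \<one>"
  have closed: "?p xs \<in> carrier M" if "xs \<in> lists S" for xs
    using that S by (induction xs) auto
  have append: "?p (xs @ ys) = ?p xs \<otimes> ?p ys" if "xs \<in> lists S" "ys \<in> lists S" for xs ys
    using that(1)
  proof (induction xs)
    case Nil
    then show ?case using closed that by simp
  next
    case (Cons x xs)
    have "x \<in> carrier M" using Cons.hyps S by blast
    then show ?case using Cons closed that by (simp add: m_assoc)
  qed
  have p_snoc: "?p (xs @ [g]) = ?p xs \<otimes> g" if "xs \<in> lists S" "g \<in> S" for xs g
  proof -
    have "g \<otimes> \<one> = g" using that S by (intro r_one) blast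
    then show ?thesis using append[of xs "[g]"] that by simp
  qed
  have inj: "xs = ys" if "xs \<in> lists S" "ys \<in> lists S" "?p xs = ?p ys" for xs ys
    using that
  proof (induction xs arbitrary: ys rule: rev_induct)
    case Nil
    show ?case
    proof (cases ys rule: rev_cases)
      case (snoc ys' h)
      have "ys' \<in> lists S" "h \<in> S" using Nil(2) snoc by auto
      then have "?p ys' \<otimes> h = \<one>" using p_snoc[of ys' h] Nil(3) unfolding snoc by simp
      then show ?thesis using one closed \<open>ys' \<in> lists S\<close> \<open>h \<in> S\<close> by blast
    qed simp
  next
    case (snoc g xs)
    have g: "xs \<in> lists S" "g \<in> S" using snoc.prems by auto
    show ?case
    proof (cases ys rule: rev_cases)
      case Nil
      then have "?p xs \<otimes> g = \<one>" using snoc.prems p_snoc[OF g] by simp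
      then show ?thesis using one closed g by blast
    next
      case ys: (snoc ys' h)
      have h: "ys' \<in> lists S" "h \<in> S" using snoc.prems ys by auto
      have "?p xs \<otimes> g = ?p ys' \<otimes> h" using snoc.prems(3) p_snoc g h ys by metis
      then have "?p xs = ?p ys'" "g = h" using unique closed g h by blast+
      then show ?thesis using snoc.IH g h ys by blast
    qed
  qed
  have surj: "\<exists>xs\<in>lists S. x = ?p xs" if "x \<in> carrier M" for x
    using that
  proof (induction "size x" arbitrary: x rule: less_induct)
    case less
    show ?case
    proof (cases "x = \<one>")
      case True
      then show ?thesis by (intro bexI[of _ "[]"]) auto
    next
      case False
      then obtain y g where y: "y \<in> carrier M" "g \<in> S" "x = y \<otimes> g" "size y < size x"
        using factor less.prems by blast
      then obtain xs where "xs \<in> lists S" "y = ?p xs" using less.hyps by blast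
      then have "xs @ [g] \<in> lists S" "x = ?p (xs @ [g])" using y p_snoc by auto
      then show ?thesis by blast
    qed
  qed
  have "?p \<in> hom (word_monoid S) M"
    using closed append by (intro homI) (auto simp: word_monoid_def)
  moreover have "?p ` lists S = carrier M"
    using closed surj by blast
  then have "bij_betw ?p (carrier (word_monoid S)) (carrier M)"
    using inj by (auto simp: word_monoid_def bij_betw_def inj_on_def)
  ultimately show ?thesis unfolding free_monoid_on_def iso_def using M S by blast
qed

theorem proposition4p2:
  shows "free_monoid_on M2 M2_generators"
proof (rule free_monoid_onI[where size = "\<lambda>x. length (snd x)"])
  show "monoid M2" by (rule monoid_M2)
  show sub: "M2_generators \<subseteq> carrier M2"
    by (auto simp: generators_iff carrier_M2)
  fix x assume x: "x \<in> carrier M2" "x \<noteq> \<one>\<^bsub>M2\<^esub>"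
  obtain w v where wv: "x = (w, v)" by (cases x)
  then obtain n where n: "dexter_le (Suc n) w v" using x carrier_M2 by blast
  \<comment> \<open>The only Dyck path of size 1 is \<open>10\<close>, so size 1 would make
    \<open>x\<close> the unit.\<close>
  have "n \<noteq> 0"
  proof
    assume "n = 0"
    have "z = [One, Zero]" if "z \<in> dyck (Suc 0)" for z
    proof -
      have "bal z" "z \<noteq> []" using that by (auto simp: dyck_iff)
      then obtain q r where "z = One # q @ Zero # r" by (rule dyck_first_return)
      then show ?thesis using length_dyck[OF that] by simp
    qed
    then show False using n x wv \<open>n = 0\<close> by (auto simp: dexter_le_def one_M2)
  qed
  then obtain n' where "v \<in> dyck (Suc (Suc n'))" using n by (cases n) (auto simp: dexter_le_def)
  then obtain m k u' g' where v: "v = u' \<sharp> g'" "u' \<in> dyck (Suc m)" "g' \<in> dyck (Suc (Suc k))"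
    "max_generator g'"
    by (rule dyck_right_factor)
  moreover have "step\<^sup>*\<^sup>* w v" using n by (simp add: dexter_le_iff)
  \<comment> \<open>The factorisation of the maximum \<open>v\<close> imposes one on the lower bound
    \<open>w\<close>.\<close>
  ultimately obtain u g where w: "w = u \<sharp> g" "dexter_le (Suc m) u u'" "dexter_le (Suc (Suc k)) g g'"
    using below_sharpE[of w u' g' m "Suc k"] by blast
  have "(u, u') \<in> carrier M2" "(g, g') \<in> M2_generators" "x = (u, u') \<otimes>\<^bsub>M2\<^esub> (g, g')"
    using v w wv by (auto simp: carrier_M2 generators_iff mult_M2)
  moreover have "length u' < length v"
    using v length_dyck[OF sharp_dyck[OF v(2,3)]] length_dyck[OF v(2)] by simp
  ultimately show "\<exists>y\<in>carrier M2. \<exists>g\<in>M2_generators. x = y \<otimes>\<^bsub>M2\<^esub> g \<and> length (snd y) < length (snd x)"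
    using wv by fastforce
next
  fix y g assume yg: "y \<in> carrier M2" "g \<in> M2_generators"
  obtain u u' h h' where e: "y = (u, u')" "g = (h, h')" by (cases y; cases g)
  obtain m n where "u' \<in> dyck (Suc m)" "h' \<in> dyck (Suc (Suc n))"
    using yg e by (auto simp: carrier_M2 generators_iff dexter_le_def)
  then have "length (u' \<sharp> h') = 2 * Suc (m + Suc n)" by (intro length_dyck sharp_dyck)
  then have "u' \<sharp> h' \<noteq> [One, Zero]" by (intro notI) simp
  then show "y \<otimes>\<^bsub>M2\<^esub> g \<noteq> \<one>\<^bsub>M2\<^esub>" using e by (simp add: mult_M2 one_M2)
next
  fix x y x' y'
  assume xy: "x \<in> carrier M2" "y \<in> M2_generators" "x' \<in> carrier M2" "y' \<in> M2_generators"
    and eq: "x \<otimes>\<^bsub>M2\<^esub> y = x' \<otimes>\<^bsub>M2\<^esub> y'"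
  obtain u v g h where e: "x = (u, v)" "y = (g, h)" by (cases x; cases y)
  obtain u' v' g' h' where e': "x' = (u', v')" "y' = (g', h')" by (cases x'; cases y')
  have eqs: "u \<sharp> g = u' \<sharp> g'" "v \<sharp> h = v' \<sharp> h'" using eq e e' by (auto simp: mult_M2)
  obtain m k where d: "u \<in> dyck (Suc m)" "v \<in> dyck (Suc m)" "g \<in> dyck (Suc k)" "h \<in> dyck (Suc k)"
    using xy e by (auto simp: carrier_M2 generators_iff dexter_le_def)
  obtain m' k' where d': "u' \<in> dyck (Suc m')" "v' \<in> dyck (Suc m')" "g' \<in> dyck (Suc k')" "h' \<in> dyck (Suc k')"
    using xy e' by (auto simp: carrier_M2 generators_iff dexter_le_def)
  have "max_generator h" "max_generator h'" using xy e e' by (auto simp: generators_iff)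
  moreover have "v \<noteq> []" "v' \<noteq> []" using d d' by (auto simp: dyck_iff)
  ultimately have hh: "h = h'"
    using max_generator_unique[OF _ _ _ _ _ _ eqs(2)] d d' by (auto simp: dyck_iff)
  \<comment> \<open>\<open>sharp_cancel\<close> requires left factors of equal size:
    \<open>h = h'\<close> fixes the size on the right, and the total size then fixes
    \<open>m\<close>. Both ends of an interval have the same size, so this serves lower bounds and
    maxima alike.\<close>
  have "k = k'" using hh d d' by (auto simp: dyck_iff)
  moreover have "Suc (m + k) = Suc (m' + k')"
    using sharp_dyck[OF d(2,4)] sharp_dyck[OF d'(2,4)] eqs(2) by (auto simp: dyck_iff)
  ultimately have "m = m'" by simp
  moreover have "bal z" "z \<noteq> []" if "z \<in> {g, g', h, h'}" for z
    using that d d' by (auto simp: dyck_iff)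
  ultimately have "u = u' \<and> g = g'" "v = v' \<and> h = h'"
    using sharp_cancel[OF d(1) _ _ _ _ _ eqs(1)] sharp_cancel[OF d(2) _ _ _ _ _ eqs(2)] d'
    by simp_all
  then show "x = x' \<and> y = y'" using e e' by simp
qed

end
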